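(* Let $l,m,n$ be positive integers, let $f_{11}(x),\dots,f_{1l}(x),f_{21}(x),\dots,f_{2m}(x),g_1(x),\dots,g_n(x)\in\mathbb{Z}[x]$, and let $\alpha_1,\dots,\alpha_l,\beta_1,\dots,\beta_m,\gamma_1,\dots,\gamma_n$ be positive integers. Let $$f(x)=f_{11}(x)^{\alpha_1}f_{12}(x)^{\alpha_2}\cdots f_{1l}(x)^{\alpha_l}\pm f_{21}(x)^{\beta_1}f_{22}(x)^{\beta_2}\cdots f_{2m}(x)^{\beta_m}$$ (with either choice of sign) and $$g(y)=g_1(y)^{\gamma_1}g_2(y)^{\gamma_2}\cdots g_n(y)^{\gamma_n}.$$ Suppose that: (1) $\deg g(y)>\deg f(x)$; (2) $\deg f(x)>1+\deg\bigl(f_{11}(x)f_{12}(x)\cdots f_{1l}(x)\,f_{21}(x)\cdots f_{2m}(x)\,g_1(x)\cdots g_n(x)\bigr)$; (3) $f_{11}(x)f_{12}(x)\cdots f_{1l}(x)$ and $f_{21}(x)\cdots f_{2m}(x)$ have no common factor in $\mathbb{Z}[x]$ (other than the units $\pm1$); (4) the leading coefficient of each of the products $f_{11}(x)\cdots f_{1l}(x)$, $f_{21}(x)\cdots f_{2m}(x)$, $g_1(x)\cdots g_n(x)$ is positive. If the $ABC$-Conjecture is assumed, then the equation $f(x)=g(y)$ has finitely many solutions $(x,y)$ in integers.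
   Context: The $ABC$-Conjecture is the following assertion: for every fixed $\epsilon>0$ there is a constant $C_\epsilon$ such that, whenever $a,b,c$ are coprime positive integers with $a+b=c$, one has $c\le C_\epsilon\,N(a,b,c)^{1+\epsilon}$, where $N(a,b,c)$ is the product of the distinct prime divisors of $abc$. *)

theory Defs
  imports Complex_Main "HOL-Computational_Algebra.Computational_Algebra"
begin

definition abc_radical :: "nat \<Rightarrow> nat \<Rightarrow> nat \<Rightarrow> nat" where
  "abc_radical a b c = \<Prod>(prime_factors (a * b * c))"

definition ABC_Conjecture :: bool where
  "ABC_Conjecture \<longleftrightarrow>
     (\<forall>\<epsilon>::real. \<epsilon> > 0 \<longrightarrow>
       (\<exists>C::real. \<forall>a b c :: nat.
          a > 0 \<and> b > 0 \<and> c > 0 \<and> Gcd {a, b, c} = 1 \<and> a + b = c \<longrightarrow>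
          real c \<le> C * real (abc_radical a b c) powr (1 + \<epsilon>)))"

end

theory Submission
  imports Defs
begin

text \<open>Write \<^term>\<open>f = A + B\<close>, where \<^term>\<open>A\<close> and \<^term>\<open>B\<close> are the two (signed) products. As they are
  coprime, \<^term>\<open>gcd (poly A x) (poly B x)\<close> divides a fixed nonzero constant, so ABC applies, up to
  that constant, to \<^term>\<open>poly A x + poly B x = poly g y\<close>.
  Since \<^term>\<open>degree g > degree f\<close>, a solution with large \<^term>\<open>\<bar>x\<bar>\<close> has \<^term>\<open>\<bar>y\<bar> \<le> \<bar>x\<bar>\<close>.
  The radical is therefore of order at most \<^term>\<open>degree f - 2\<close> in \<^term>\<open>\<bar>x\<bar>\<close>, while
  \<^term>\<open>poly f x\<close> has order \<^term>\<open>degree f\<close>; taking \<^term>\<open>\<epsilon> = 1 / degree f\<close> bounds \<^term>\<open>x\<close>.\<close>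

section \<open>Bezout identity for coprime integer polynomials, up to a constant\<close>

text \<open>A divisor of a nonzero constant is constant, and a constant dividing \<open>p\<close>
  divides its content. This cancels the scalar that pseudo-division introduces.\<close>

lemma coprime_const_primitive:
  fixes p :: "int poly"
  assumes "content p = 1" and "a \<noteq> 0"
  shows "coprime p [:a:]"
proof (rule coprimeI)
  fix k assume k: "k dvd p" "k dvd [:a:]"
  then have "degree k = 0"
    using dvd_imp_degree_le[of k "[:a:]"] assms(2) by simp
  then obtain c where c: "k = [:c:]" by (rule degree_eq_zeroE)
  then have "c dvd content p"
    using k(1) by (simp add: const_poly_dvd_iff_dvd_content)
  then show "is_unit k"
    using assms(1) c by (simp add: is_unit_const_poly_iff)
qed

text \<open>A nonzero element of minimal degree in the ideal generated by \<^term>\<open>A\<close> and \<^term>\<open>B\<close>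
  divides constant multiples of both, so its primitive part is a unit.\<close>

lemma coprime_int_poly_bezout:
  fixes A B :: "int poly"
  assumes cop: "coprime A B"
  obtains S T r where "S * A + T * B = [:r:]" and "r \<noteq> 0"
proof -
  define I where "I e \<longleftrightarrow> (\<exists>S T. e = S * A + T * B)" for e
  have "\<not> (A = 0 \<and> B = 0)"
    using cop by auto
  moreover have IA: "I A"
    unfolding I_def by (rule exI[of _ 1], rule exI[of _ 0]) simp
  moreover have IB: "I B"
    unfolding I_def by (rule exI[of _ 0], rule exI[of _ 1]) simp
  ultimately have "\<exists>e. I e \<and> e \<noteq> 0" by blast
  then obtain e where e: "I e" "e \<noteq> 0"
    and min: "\<And>e'. I e' \<Longrightarrow> e' \<noteq> 0 \<Longrightarrow> degree e \<le> degree e'"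
    using exists_least_iff[of "\<lambda>d. \<exists>e. I e \<and> e \<noteq> 0 \<and> degree e = d"]
    by (metis not_le)
  have "primitive_part e dvd p" if Ip: "I p" for p
  proof -
    obtain q r where qr: "pseudo_divmod p e = (q, r)" by fastforce
    \<comment> \<open>The scalar by which pseudo-division multiplies \<open>p\<close> so that
      division by \<open>e\<close> succeeds over the integers. The remainder stays in the ideal, so
      minimality of the degree forces it to vanish.\<close>
    define a where "a = lead_coeff e ^ (Suc (degree p) - degree e)"
    have a0: "a \<noteq> 0" using e(2) by (simp add: a_def)
    have eq: "smult a p = e * q + r" and deg: "r = 0 \<or> degree r < degree e"
      using pseudo_divmod[OF e(2) qr] by (auto simp: a_def)
    obtain S T S' T' where ST: "e = S * A + T * B" "p = S' * A + T' * B"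
      using e(1) Ip unfolding I_def by blast
    have "r = smult a p - e * q" using eq by simp
    also have "\<dots> = (smult a S' - q * S) * A + (smult a T' - q * T) * B"
      unfolding ST by (simp add: algebra_simps smult_add_right)
    finally have "I r" unfolding I_def by blast
    then have "r = 0" using deg min by (meson not_le)
    then have "e dvd [:a:] * p" using eq by simp
    then have "primitive_part e dvd [:a:] * p"
      by (metis content_times_primitive_part dvd_refl dvd_trans smult_dvd_cancel)
    moreover have "coprime (primitive_part e) [:a:]"
      using coprime_const_primitive a0 e(2) by simp
    ultimately show ?thesis by (simp only: coprime_dvd_mult_right_iff)
  qed
  then have "is_unit (primitive_part e)"
    using cop IA IB by (meson coprime_common_divisor)
  then have "degree e = 0"
    by (metis degree_primitive_part is_unit_iff_degree is_unitE degree_1 dvd_imp_degree_le le_zero_eq zero_neq_one)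
  then obtain r where "e = [:r:]" by (rule degree_eq_zeroE)
  then show ?thesis
    using that e unfolding I_def by (metis pCons_0_0)
qed

section \<open>ABC for signed integers with a controlled gcd\<close>

text \<open>Distinct primes are coprime, so their product divides whatever each of them divides.
  This later bounds the radical.\<close>

lemma prod_prime_factors_dvd:
  fixes n N :: nat
  assumes "\<And>p. prime p \<Longrightarrow> p dvd n \<Longrightarrow> p dvd N"
  shows "\<Prod>(prime_factors n) dvd N"
proof -
  have "(\<Prod>p\<in>P. p) dvd N" if "finite P" "P \<subseteq> prime_factors n" for P
    using that
  proof (induction P rule: finite_induct)
    case (insert p P)
    have "coprime p (\<Prod>q\<in>P. q)"
      using insert by (intro prod_coprime_right) (auto intro!: primes_coprime)
    moreover have "p dvd N" using insert assms by auto
    ultimately show ?case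
      using insert by (auto intro!: divides_mult)
  qed simp
  from this[of "prime_factors n"] show ?thesis by simp
qed

text \<open>The largest of |u|, |v|, |u + v| is the sum of the other two, which reduces every choice
  of signs to the positive case. Replacing the radical by any suitable \<open>N\<close> allows
  \<open>N\<close> to be a product of polynomial values later.\<close>

lemma ABC_Conjecture_int:
  fixes \<epsilon> :: real
  assumes "ABC_Conjecture" and "\<epsilon> > 0"
  obtains C :: real where "C > 0"
    and "\<And>(u::int) (v::int) (N::int). u \<noteq> 0 \<Longrightarrow> v \<noteq> 0 \<Longrightarrow> u + v \<noteq> 0 \<Longrightarrow> coprime u v \<Longrightarrow> N > 0 \<Longrightarrow>
      (\<And>p. prime p \<Longrightarrow> p dvd u * v * (u + v) \<Longrightarrow> p dvd N) \<Longrightarrow>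
      \<bar>u + v\<bar> \<le> C * N powr (1 + \<epsilon>)"
proof -
  obtain C0 :: real where C0: "\<And>a b c :: nat.
      a > 0 \<Longrightarrow> b > 0 \<Longrightarrow> c > 0 \<Longrightarrow> Gcd {a, b, c} = 1 \<Longrightarrow> a + b = c \<Longrightarrow>
      real c \<le> C0 * real (abc_radical a b c) powr (1 + \<epsilon>)"
    using assms unfolding ABC_Conjecture_def by metis
  \<comment> \<open>The maximum makes the constant positive, as the later multiplications of
    inequalities require.\<close>
  define C where "C = max C0 1"
  have nat_bound: "real c \<le> C * real N powr (1 + \<epsilon>)"
    if "a > 0" "b > 0" "a + b = c" "coprime a b" "N > 0"
      and primes: "\<And>p. prime p \<Longrightarrow> p dvd a * b * c \<Longrightarrow> p dvd N" for a b c N :: nat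
  proof -
    have "abc_radical a b c dvd N"
      unfolding abc_radical_def using primes by (rule prod_prime_factors_dvd)
    then have "abc_radical a b c \<le> N" using \<open>N > 0\<close> by (rule dvd_imp_le)
    then have "real (abc_radical a b c) powr (1 + \<epsilon>) \<le> real N powr (1 + \<epsilon>)"
      using assms(2) by (intro powr_mono2) auto
    moreover have "Gcd {a, b, c} = 1"
      using \<open>coprime a b\<close> by (simp add: gcd.assoc[symmetric])
    ultimately show ?thesis
      using C0[of a b c] that(1-3)
      by (smt (verit) C_def add_gr_0 mult_mono powr_ge_zero)
  qed
  show ?thesis
  proof (rule that[of C])
    show "C > 0" by (simp add: C_def)
    fix u v N :: int
    assume nz: "u \<noteq> 0" "v \<noteq> 0" "u + v \<noteq> 0" and cop: "coprime u v" and N: "N > 0"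
      and primes: "\<And>p. prime p \<Longrightarrow> p dvd u * v * (u + v) \<Longrightarrow> p dvd N"
    define a b c where "a = nat \<bar>u\<bar>" "b = nat \<bar>v\<bar>" "c = nat \<bar>u + v\<bar>"
    note abc = this
    have P: "p dvd nat N" if "prime p" "p dvd a * b * c" for p
    proof -
      have "int p dvd int (a * b * c)" using that(2) by (simp only: of_nat_dvd_iff)
      then have "int p dvd \<bar>u * v * (u + v)\<bar>" by (simp add: abc abs_mult)
      then have "int p dvd N" using primes[of "int p"] that(1) by simp
      then show ?thesis using N by (metis int_dvd_int_iff int_nat_eq less_imp_le)
    qed
    have pos: "a > 0" "b > 0" "c > 0" "nat N > 0" using nz N by (auto simp: abc)
    have ab: "coprime a b" using cop by (simp add: abc)
    consider "a + b = c" | "b + c = a" | "a + c = b"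
      unfolding abc by linarith
    then have "real c \<le> C * real (nat N) powr (1 + \<epsilon>)"
    proof cases
      case 1
      then show ?thesis using nat_bound[OF pos(1,2) _ ab pos(4)] P by blast
    next
      case 2
      then have "coprime b c"
        using ab by (metis coprime_iff_gcd_eq_1 gcd.commute gcd_add2)
      then have "real a \<le> C * real (nat N) powr (1 + \<epsilon>)"
        using nat_bound[OF pos(2,3) 2 _ pos(4)] P by (simp only: ac_simps)
      then show ?thesis using 2 by linarith
    next
      case 3
      then have "coprime a c"
        using ab by (metis coprime_iff_gcd_eq_1 gcd_add2)
      then have "real b \<le> C * real (nat N) powr (1 + \<epsilon>)"
        using nat_bound[OF pos(1,3) 3 _ pos(4)] P by (simp only: ac_simps)
      then show ?thesis using 3 by linarith
    qed
    then show "\<bar>u + v\<bar> \<le> C * N powr (1 + \<epsilon>)" using N by (simp add: abc)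
  qed
qed

text \<open>Dividing \<open>u\<close> and \<open>v\<close> by their gcd \<open>d\<close> gives a
  coprime pair without new primes; multiplying back costs a factor \<open>d\<close>, which is at
  most |r|.\<close>

lemma ABC_Conjecture_int_gcd:
  fixes \<epsilon> :: real
  assumes "ABC_Conjecture" and "\<epsilon> > 0"
  obtains C :: real where "C > 0"
    and "\<And>(u::int) (v::int) (N::int) (r::int).
      u \<noteq> 0 \<Longrightarrow> v \<noteq> 0 \<Longrightarrow> u + v \<noteq> 0 \<Longrightarrow> N > 0 \<Longrightarrow>
      r \<noteq> 0 \<Longrightarrow> gcd u v dvd r \<Longrightarrow>
      (\<And>p. prime p \<Longrightarrow> p dvd u * v * (u + v) \<Longrightarrow> p dvd N) \<Longrightarrow>
      \<bar>u + v\<bar> \<le> C * \<bar>r\<bar> * N powr (1 + \<epsilon>)"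
proof -
  obtain C where "C > 0" and C: "\<And>(u::int) (v::int) (N::int). u \<noteq> 0 \<Longrightarrow> v \<noteq> 0 \<Longrightarrow> u + v \<noteq> 0 \<Longrightarrow>
      coprime u v \<Longrightarrow> N > 0 \<Longrightarrow> (\<And>p. prime p \<Longrightarrow> p dvd u * v * (u + v) \<Longrightarrow> p dvd N) \<Longrightarrow>
      \<bar>u + v\<bar> \<le> C * N powr (1 + \<epsilon>)"
    using ABC_Conjecture_int[OF assms] by blast
  show ?thesis
  proof (rule that[OF \<open>C > 0\<close>])
    fix u v N r :: int
    assume nz: "u \<noteq> 0" "v \<noteq> 0" "u + v \<noteq> 0" and N: "N > 0" and r: "r \<noteq> 0" "gcd u v dvd r"
      and primes: "\<And>p. prime p \<Longrightarrow> p dvd u * v * (u + v) \<Longrightarrow> p dvd N"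
    define d where "d = gcd u v"
    obtain u' v' where uv: "u = u' * d" "v = v' * d" "coprime u' v'"
      using gcd_coprime_exists[of u v] nz unfolding d_def by auto
    have "d > 0" using nz by (simp add: d_def)
    have sum: "u + v = d * (u' + v')" by (simp add: uv algebra_simps)
    have "u' * v' * (u' + v') dvd u * v * (u + v)"
      unfolding sum by (intro mult_dvd_mono) (simp_all add: uv)
    then have "\<And>p. prime p \<Longrightarrow> p dvd u' * v' * (u' + v') \<Longrightarrow> p dvd N"
      using primes dvd_trans by blast
    then have "\<bar>u' + v'\<bar> \<le> C * N powr (1 + \<epsilon>)"
      using C[of u' v' N] nz N uv sum by auto
    moreover have "d \<le> \<bar>r\<bar>" using r by (simp add: d_def zdvd_imp_le)
    ultimately have "\<bar>r\<bar> * (C * N powr (1 + \<epsilon>)) \<ge> d * real_of_int \<bar>u' + v'\<bar>"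
      using \<open>d > 0\<close> by (intro mult_mono) auto
    then show "\<bar>u + v\<bar> \<le> C * \<bar>r\<bar> * N powr (1 + \<epsilon>)"
      using \<open>d > 0\<close> by (simp add: sum abs_mult ac_simps)
  qed
qed

section \<open>Growth of integer polynomials\<close>

text \<open>A free bound \<open>X\<close> in place of |x| lets powers of the same \<open>X\<close>
  dominate values at both \<open>x\<close> and \<open>y\<close>.\<close>

lemma int_poly_upper_bound:
  fixes p :: "int poly"
  obtains K :: real where "K > 0"
    and "\<And>x X. \<bar>real_of_int x\<bar> \<le> X \<Longrightarrow> 1 \<le> X \<Longrightarrow> \<bar>poly p x\<bar> \<le> K * X ^ degree p"
proof
  \<comment> \<open>The added 1 keeps the constant positive even for \<open>p = 0\<close>.\<close>
  let ?K = "(\<Sum>i\<le>degree p. \<bar>real_of_int (coeff p i)\<bar>) + 1"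
  show "?K > 0" by (smt (verit) abs_ge_zero sum_nonneg)
  fix x :: int and X :: real
  assume x: "\<bar>real_of_int x\<bar> \<le> X" and X: "1 \<le> X"
  have "\<bar>real_of_int (poly p x)\<bar> \<le> (\<Sum>i\<le>degree p. \<bar>real_of_int (coeff p i) * real_of_int x ^ i\<bar>)"
    by (simp add: poly_altdef sum_abs)
  also have "\<dots> \<le> (\<Sum>i\<le>degree p. \<bar>real_of_int (coeff p i)\<bar> * X ^ degree p)"
  proof (rule sum_mono)
    fix i assume "i \<in> {..degree p}"
    then have "\<bar>real_of_int x\<bar> ^ i \<le> X ^ degree p"
      using x X by (meson abs_ge_zero atMost_iff order_trans power_increasing power_mono)
    then show "\<bar>real_of_int (coeff p i) * real_of_int x ^ i\<bar>
        \<le> \<bar>real_of_int (coeff p i)\<bar> * X ^ degree p"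
      by (simp add: abs_mult power_abs mult_left_mono)
  qed
  also have "\<dots> \<le> ?K * X ^ degree p"
    using X by (simp add: sum_distrib_right[symmetric] distrib_right)
  finally show "\<bar>poly p x\<bar> \<le> ?K * X ^ degree p" by simp
qed

text \<open>The quotient of \<open>p\<close> by \<open>x ^ degree p\<close> tends to the leading
  coefficient; half its absolute value serves as \<open>c\<close>.\<close>

lemma int_poly_lower_bound:
  fixes p :: "int poly"
  assumes "p \<noteq> 0"
  obtains c M :: real where "c > 0"
    and "\<And>x::int. M \<le> \<bar>x\<bar> \<Longrightarrow> c * \<bar>x\<bar> ^ degree p \<le> \<bar>poly p x\<bar>"
proof -
  define q :: "real poly" where "q = map_poly of_int p"
  have q: "poly q (of_int x) = of_int (poly p x)" for x :: int
    unfolding q_def by (simp add: poly_altdef degree_map_poly coeff_map_poly)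
  have deg: "degree q = degree p"
    unfolding q_def by (rule degree_map_poly) simp
  define a where "a = \<bar>lead_coeff q\<bar>"
  have "a > 0"
    unfolding a_def deg using assms by (simp add: q_def coeff_map_poly)
  have "((\<lambda>x. \<bar>poly q x / x ^ degree q\<bar>) \<longlongrightarrow> a) at_infinity"
    unfolding a_def by (intro tendsto_rabs poly_divide_tendsto_aux)
  then have "\<forall>\<^sub>F x in at_infinity. a / 2 < \<bar>poly q x / x ^ degree q\<bar>"
    using \<open>a > 0\<close> by (intro order_tendstoD(1)) auto
  then obtain M where M: "\<And>x. M \<le> \<bar>x\<bar> \<Longrightarrow> a / 2 < \<bar>poly q x / x ^ degree q\<bar>"
    by (auto simp: eventually_at_infinity)
  show ?thesis
  proof (rule that[of "a / 2" "max M 1"])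
    show "a / 2 > 0" using \<open>a > 0\<close> by simp
    fix x :: int assume x: "max M 1 \<le> \<bar>x\<bar>"
    then have "a / 2 < \<bar>poly p x\<bar> / \<bar>real_of_int x\<bar> ^ degree p"
      using M[of "real_of_int x"] by (simp add: q deg abs_divide power_abs)
    moreover have "x \<noteq> 0" using x by auto
    then have "\<bar>real_of_int x\<bar> ^ degree p > 0" by simp
    ultimately show "a / 2 * \<bar>x\<bar> ^ degree p \<le> \<bar>poly p x\<bar>"
      by (simp add: pos_less_divide_eq)
  qed
qed

section \<open>From ABC to finiteness of the solutions\<close>

lemma prime_dvd_poly_if_dvd_power:
  fixes A F :: "int poly"
  assumes "A dvd F ^ k" and "prime p" and "p dvd poly A x"
  shows "p dvd poly F x"
proof -
  have "poly A x dvd poly F x ^ k"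
    using assms(1) by (metis poly_power dvdE poly_mult dvd_triv_left)
  then show ?thesis
    using assms(2,3) by (meson dvd_trans prime_dvd_power)
qed

lemma finite_poly_fibre:
  fixes p :: "'a :: idom poly"
  assumes "degree p > 0"
  shows "finite {x. poly p x = c}"
proof -
  have "p - [:c:] \<noteq> 0"
    using assms by auto
  then have "finite {x. poly (p - [:c:]) x = 0}" by (rule poly_roots_finite)
  then show ?thesis by simp
qed

text \<open>\<open>F\<close> and \<open>H\<close> stand for the products of the bases: up to
  multiplicity, \<open>F\<close> has the prime factors of \<open>A * B\<close> and \<open>H\<close>
  those of \<open>g\<close>. Nonvanishing of \<open>A * B * f\<close> at \<open>x\<close> keeps all
  three terms in ABC nonzero.\<close>

lemma ABC_bounded_solutions:
  fixes A B F H f g :: "int poly"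
  assumes f: "f = A + B" and cop: "coprime A B"
    and deg_fg: "degree f < degree g" and deg: "1 + degree (F * H) < degree f"
    and F: "F dvd A * B" "A * B dvd F ^ k" and H: "H dvd g" "g dvd H ^ k"
    and nz: "F \<noteq> 0" "H \<noteq> 0"
    and abc: "ABC_Conjecture"
  obtains M :: real
  where "\<And>x y :: int. poly f x = poly g y \<Longrightarrow> poly (A * B * f) x \<noteq> 0 \<Longrightarrow> \<bar>x\<bar> \<le> M"
proof -
  define D where "D = degree f"
  \<comment> \<open>With this choice (D - 2)(1 + \<epsilon>) = D - 1 - 2/D, which stays below D -
    1.\<close>
  define \<epsilon> where "\<epsilon> = 1 / real D"
  have "D \<ge> 2" using deg by (simp add: D_def)
  then have "\<epsilon> > 0" by (simp add: \<epsilon>_def)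
  obtain S T r where bez: "S * A + T * B = [:r:]" and "r \<noteq> 0"
    using coprime_int_poly_bezout[OF cop] .
  obtain C :: real where "C > 0" and C: "\<And>(u::int) (v::int) (N::int) (r::int).
      u \<noteq> 0 \<Longrightarrow> v \<noteq> 0 \<Longrightarrow> u + v \<noteq> 0 \<Longrightarrow> N > 0 \<Longrightarrow>
      r \<noteq> 0 \<Longrightarrow> gcd u v dvd r \<Longrightarrow>
      (\<And>p. prime p \<Longrightarrow> p dvd u * v * (u + v) \<Longrightarrow> p dvd N) \<Longrightarrow>
      \<bar>u + v\<bar> \<le> C * \<bar>r\<bar> * N powr (1 + \<epsilon>)"
    using ABC_Conjecture_int_gcd[OF abc \<open>\<epsilon> > 0\<close>] by blast
  have "f \<noteq> 0" "g \<noteq> 0" using deg deg_fg by auto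
  obtain c Mf :: real where "c > 0" and c: "\<And>x::int. Mf \<le> \<bar>x\<bar> \<Longrightarrow> c * \<bar>x\<bar> ^ D \<le> \<bar>poly f x\<bar>"
    using int_poly_lower_bound[OF \<open>f \<noteq> 0\<close>] unfolding D_def by blast
  obtain b Mg :: real where "b > 0" and b: "\<And>x::int. Mg \<le> \<bar>x\<bar> \<Longrightarrow> b * \<bar>x\<bar> ^ degree g \<le> \<bar>poly g x\<bar>"
    using int_poly_lower_bound[OF \<open>g \<noteq> 0\<close>] by blast
  obtain Kf :: real where Kf: "\<And>x X. \<bar>real_of_int x\<bar> \<le> X \<Longrightarrow> 1 \<le> X \<Longrightarrow> \<bar>poly f x\<bar> \<le> Kf * X ^ D"
    using int_poly_upper_bound[of f] unfolding D_def by blast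
  obtain K1 :: real where "K1 > 0" and K1: "\<And>x X. \<bar>real_of_int x\<bar> \<le> X \<Longrightarrow> 1 \<le> X \<Longrightarrow>
      \<bar>poly F x\<bar> \<le> K1 * X ^ degree F"
    using int_poly_upper_bound[of F] by blast
  obtain K2 :: real where "K2 > 0" and K2: "\<And>x X. \<bar>real_of_int x\<bar> \<le> X \<Longrightarrow> 1 \<le> X \<Longrightarrow>
      \<bar>poly H x\<bar> \<le> K2 * X ^ degree H"
    using int_poly_upper_bound[of H] by blast
  define K where "K = C * \<bar>r\<bar> * (K1 * K2) powr (1 + \<epsilon>)"
  \<comment> \<open>Beyond \<open>Mf\<close> and \<open>Mg\<close> the lower bounds hold;
    \<open>Kf / b\<close> rules out |y| > |x|, and \<open>K / c\<close> gives the final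
    contradiction.\<close>
  define M where "M = Max {1, Mf, Mg, Kf / b, K / c}"
  have M: "M \<ge> 1" "M \<ge> Mf" "M \<ge> Mg" "M \<ge> Kf / b" "M \<ge> K / c"
    unfolding M_def by auto
  show ?thesis
  proof (rule that[of M], rule ccontr)
    fix x y :: int
    assume eq: "poly f x = poly g y" and root: "poly (A * B * f) x \<noteq> 0"
    define X where "X = real_of_int \<bar>x\<bar>"
    assume "\<not> \<bar>real_of_int x\<bar> \<le> M"
    then have X: "X > M" "X \<ge> 1" using M by (auto simp: X_def)
    have yX: "\<bar>real_of_int y\<bar> \<le> X"
    proof (rule ccontr)
      assume "\<not> \<bar>real_of_int y\<bar> \<le> X"
      then obtain Z where Z: "Z = \<bar>real_of_int y\<bar>" "Z > X" by auto
      \<comment> \<open>As \<open>degree g\<close> is at least D + 1, the value of \<open>g\<close>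
        at a \<open>y\<close> with |y| = Z > X outgrows that of \<open>f\<close> at
        \<open>x\<close>.\<close>
      have "b * Z * Z ^ D \<le> b * Z ^ degree g"
        using power_increasing[of "Suc D" "degree g" Z] Z X deg_fg \<open>b > 0\<close> by (simp add: D_def)
      also have "\<dots> \<le> \<bar>poly g y\<bar>"
        using b[of y] Z X M by simp
      also have "\<dots> \<le> Kf * Z ^ D"
        using Kf[of x Z] Z X by (simp add: eq[symmetric] X_def)
      finally have "b * Z \<le> Kf"
        using Z(2) X by (elim mult_right_le_imp_le) simp
      then have "Z \<le> Kf / b" using \<open>b > 0\<close> by (simp add: field_simps)
      then show False using Z X M by simp
    qed
    \<comment> \<open>Primes dividing A(x) B(x) divide F(x); those dividing A(x) + B(x) = g(y)
      divide H(y).\<close>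
    define N where "N = \<bar>poly F x * poly H y\<bar>"
    have "poly F x \<noteq> 0"
      using F(1) root by (metis dvdE mult_zero_left poly_mult)
    moreover have "poly H y \<noteq> 0"
      using H(1) root eq by (auto elim!: dvdE)
    ultimately have "N > 0" by (simp add: N_def)
    have "\<bar>poly A x + poly B x\<bar> \<le> C * \<bar>r\<bar> * N powr (1 + \<epsilon>)"
    proof (rule C)
      show "gcd (poly A x) (poly B x) dvd r"
      proof -
        have "r = poly S x * poly A x + poly T x * poly B x"
          using arg_cong[OF bez, of "\<lambda>p. poly p x"] by simp
        then show ?thesis by (metis dvd_add dvd_mult gcd_dvd1 gcd_dvd2)
      qed
      fix p :: int assume p: "prime p" "p dvd poly A x * poly B x * (poly A x + poly B x)"
      then have "p dvd poly (A * B) x \<or> p dvd poly g y"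
        by (simp add: prime_dvd_mult_iff eq[symmetric] f)
      then have "p dvd poly F x \<or> p dvd poly H y"
        using prime_dvd_poly_if_dvd_power[OF F(2) p(1)] prime_dvd_poly_if_dvd_power[OF H(2) p(1)]
        by blast
      then show "p dvd N" by (auto simp: N_def)
    qed (use root \<open>r \<noteq> 0\<close> \<open>N > 0\<close> f in auto)
    then have upper: "\<bar>poly f x\<bar> \<le> C * \<bar>r\<bar> * N powr (1 + \<epsilon>)" by (simp add: f)
    have "real_of_int N \<le> (K1 * X ^ degree F) * (K2 * X ^ degree H)"
      unfolding N_def abs_mult of_int_mult of_int_abs
      using K1[of x X] K2[of y X] yX X \<open>K1 > 0\<close> by (intro mult_mono) (auto simp: X_def)
    also have "\<dots> = K1 * K2 * X ^ degree (F * H)"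
      using nz by (simp add: degree_mult_eq power_add)
    \<comment> \<open>The strict inequality 1 + deg(F H) < D leaves room for the exponent D -
      2.\<close>
    also have "\<dots> \<le> K1 * K2 * X ^ (D - 2)"
      using deg X \<open>K1 > 0\<close> \<open>K2 > 0\<close> by (intro mult_left_mono power_increasing) (auto simp: D_def)
    finally have "N powr (1 + \<epsilon>) \<le> (K1 * K2 * X ^ (D - 2)) powr (1 + \<epsilon>)"
      using \<open>N > 0\<close> \<open>\<epsilon> > 0\<close> by (intro powr_mono2) auto
    also have "\<dots> = (K1 * K2) powr (1 + \<epsilon>) * X powr (real (D - 2) * (1 + \<epsilon>))"
      using X \<open>K1 > 0\<close> \<open>K2 > 0\<close> by (simp add: powr_mult powr_powr flip: powr_realpow)
    also have "\<dots> \<le> (K1 * K2) powr (1 + \<epsilon>) * X powr (real (D - 1))"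
    proof (intro mult_left_mono powr_mono)
      show "real (D - 2) * (1 + \<epsilon>) \<le> real (D - 1)"
        using \<open>D \<ge> 2\<close> by (simp add: \<epsilon>_def of_nat_diff field_simps)
    qed (use X in auto)
    also have "\<dots> = (K1 * K2) powr (1 + \<epsilon>) * X ^ (D - 1)"
      using X by (simp add: powr_realpow)
    finally have "C * \<bar>r\<bar> * N powr (1 + \<epsilon>) \<le> K * X ^ (D - 1)"
      using \<open>C > 0\<close> unfolding K_def mult.assoc by (intro mult_left_mono) auto
    moreover have "c * X * X ^ (D - 1) \<le> \<bar>poly f x\<bar>"
      using c[of x] X M \<open>D \<ge> 2\<close> by (simp add: X_def power_eq_if[of _ D])
    ultimately have "c * X * X ^ (D - 1) \<le> K * X ^ (D - 1)"
      using upper by simp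
    then have "c * X \<le> K" using X by (elim mult_right_le_imp_le) simp
    then have "X \<le> K / c" using \<open>c > 0\<close> by (simp add: field_simps)
    then show False using X M by simp
  qed
qed

text \<open>Each \<open>x\<close> is either bounded or one of the finitely many roots of
  \<open>A * B * f\<close>, and the nonconstant \<open>g\<close> allows finitely many
  \<open>y\<close> for each \<open>x\<close>.\<close>

lemma ABC_finite_solutions:
  fixes A B F H f g :: "int poly"
  assumes "f = A + B" and "coprime A B"
    and "degree f < degree g" and "1 + degree (F * H) < degree f"
    and "F dvd A * B" "A * B dvd F ^ k" and "H dvd g" "g dvd H ^ k"
    and "F \<noteq> 0" "H \<noteq> 0"
    and "ABC_Conjecture"
  shows "finite {(x::int, y::int). poly f x = poly g y}"
proof -
  obtain M :: real where M: "\<And>x y :: int. poly f x = poly g y \<Longrightarrow>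
      poly (A * B * f) x \<noteq> 0 \<Longrightarrow> \<bar>x\<bar> \<le> M"
    using ABC_bounded_solutions[OF assms] by blast
  have "A * B \<noteq> 0" using assms(6,9) by auto
  moreover have "f \<noteq> 0" using assms(4) by auto
  ultimately have "finite {x. poly (A * B * f) x = 0}"
    by (intro poly_roots_finite) simp
  moreover have "finite {x::int. \<bar>x\<bar> \<le> M}"
    by (rule finite_subset[of _ "{-\<lfloor>M\<rfloor>..\<lfloor>M\<rfloor>}"]) (auto simp: le_floor_iff abs_le_iff minus_le_iff)
  ultimately have "finite ({x. poly (A * B * f) x = 0} \<union> {x::int. \<bar>x\<bar> \<le> M})" by simp
  moreover have "finite {y. poly g y = poly f x}" for x
    using assms(3) by (intro finite_poly_fibre) simp
  ultimately have "finite (SIGMA x : {x. poly (A * B * f) x = 0} \<union> {x::int. \<bar>x\<bar> \<le> M}.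
      {y. poly g y = poly f x})"
    by (intro finite_SigmaI) auto
  then show ?thesis
    by (rule finite_subset[rotated]) (use M in fastforce)
qed

section \<open>Reduction of the products of powers to their bases\<close>

lemma prod_power_dvd_power_prod:
  fixes h :: "'b \<Rightarrow> 'a :: comm_semiring_1"
  assumes "\<And>i. i \<in> I \<Longrightarrow> e i \<le> k"
  shows "(\<Prod>i\<in>I. h i ^ e i) dvd (\<Prod>i\<in>I. h i) ^ k"
  unfolding prod_power_distrib by (intro prod_dvd_prod le_imp_power_dvd assms)

lemma prod_dvd_prod_power:
  fixes h :: "'b \<Rightarrow> 'a :: comm_semiring_1"
  assumes "\<And>i. i \<in> I \<Longrightarrow> e i > 0"
  shows "(\<Prod>i\<in>I. h i) dvd (\<Prod>i\<in>I. h i ^ e i)"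
  using assms by (intro prod_dvd_prod dvd_power) auto

theorem theorem1p5:
  fixes l m n :: nat
    and f1 f2 g' :: "nat \<Rightarrow> int poly"
    and \<alpha> \<beta> \<gamma> :: "nat \<Rightarrow> nat"
    and f g :: "int poly"
  assumes "l > 0" and "m > 0" and "n > 0"
    and "\<And>i. i \<in> {1..l} \<Longrightarrow> \<alpha> i > 0"
    and "\<And>i. i \<in> {1..m} \<Longrightarrow> \<beta> i > 0"
    and "\<And>i. i \<in> {1..n} \<Longrightarrow> \<gamma> i > 0"
    and "f = (\<Prod>i=1..l. f1 i ^ \<alpha> i) + (\<Prod>i=1..m. f2 i ^ \<beta> i) \<or>
         f = (\<Prod>i=1..l. f1 i ^ \<alpha> i) - (\<Prod>i=1..m. f2 i ^ \<beta> i)"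
    and "g = (\<Prod>i=1..n. g' i ^ \<gamma> i)"
    and "degree g > degree f"
    and "degree f > 1 + degree ((\<Prod>i=1..l. f1 i) * (\<Prod>i=1..m. f2 i) * (\<Prod>i=1..n. g' i))"
    and "coprime (\<Prod>i=1..l. f1 i) (\<Prod>i=1..m. f2 i)"
    and "lead_coeff (\<Prod>i=1..l. f1 i) > 0"
    and "lead_coeff (\<Prod>i=1..m. f2 i) > 0"
    and "lead_coeff (\<Prod>i=1..n. g' i) > 0"
    and "ABC_Conjecture"
  shows "finite {(x::int, y::int). poly f x = poly g y}"
proof -
  let ?F1 = "\<Prod>i=1..l. f1 i" and ?F2 = "\<Prod>i=1..m. f2 i" and ?H = "\<Prod>i=1..n. g' i"
  let ?A = "\<Prod>i=1..l. f1 i ^ \<alpha> i" and ?P = "\<Prod>i=1..m. f2 i ^ \<beta> i"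
  \<comment> \<open>A single exponent at least as large as every \<alpha>, \<beta> and \<gamma>
    involved.\<close>
  define k where "k = sum \<alpha> {1..l} + sum \<beta> {1..m} + sum \<gamma> {1..n}"
  have le: "i \<in> {1..l} \<Longrightarrow> \<alpha> i \<le> k" "i \<in> {1..m} \<Longrightarrow> \<beta> i \<le> k" "i \<in> {1..n} \<Longrightarrow> \<gamma> i \<le> k" for i
    using member_le_sum[of i "{1..l}" \<alpha>] member_le_sum[of i "{1..m}" \<beta>]
      member_le_sum[of i "{1..n}" \<gamma>] by (auto simp: k_def)
  have A: "?A dvd ?F1 ^ k" "?F1 dvd ?A" and P: "?P dvd ?F2 ^ k" "?F2 dvd ?P"
    and g: "g dvd ?H ^ k" "?H dvd g"
    using assms(4-6) le unfolding assms(8)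
    by (auto intro!: prod_power_dvd_power_prod prod_dvd_prod_power)
  have "coprime (?F1 ^ k) (?F2 ^ k)"
    using assms(11) by simp
  then have cop: "coprime ?A ?P"
    using A(1) P(1) by (rule coprime_divisors[rotated 2])
  \<comment> \<open>Absorbing the sign into \<open>B\<close> treats both forms of \<open>f\<close>
    at once.\<close>
  define B where "B = f - ?A"
  have B: "f = ?A + B" "B = ?P \<or> B = - ?P"
    using assms(7) unfolding B_def by auto
  have "coprime ?A B" and "?F1 * ?F2 dvd ?A * B" and "?A * B dvd (?F1 * ?F2) ^ k"
    using B(2) cop mult_dvd_mono[OF A(2) P(2)] mult_dvd_mono[OF A(1) P(1)]
    by (auto simp: power_mult_distrib)
  moreover have "?F1 \<noteq> 0" "?F2 \<noteq> 0" "?H \<noteq> 0"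
    using assms(12-14) by (metis leading_coeff_0_iff less_irrefl)+
  then have "?F1 * ?F2 \<noteq> 0" "?H \<noteq> 0" by (simp_all only: mult_eq_0_iff simp_thms)
  ultimately show ?thesis
    using B(1) assms(9,10,15) g by (intro ABC_finite_solutions[where k = k]) auto
qed

end
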